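(* Let $\{a_n\}_{n\geqslant 1}$ be a P-recursive sequence of non-negative real numbers. Suppose that there are positive integers $\rho, M$ and real numbers $\mu_0,\mu_1,\dots,\mu_\rho$, $r$, $b_0,\dots,b_M$ with \[ b_0>0 \quad\text{and}\quad M/\rho>2, \] such that, as $n\to\infty$, \[ a_n = e^{Q(\rho,n)}\, n^{r}\left(\sum_{s=0}^{M} b_s n^{-s/\rho}+o\left(n^{-M/\rho}\right)\right), \qquad Q(\rho,n)=\mu_0 n\log n+\sum_{j=1}^{\rho}\mu_j n^{j/\rho}. \] If one of the following three conditions holds, then the sequence $\{\sqrt[n]{a_n}\}_{n\geqslant 1}$ is asymptotically log-concave: (1) $\mu_0>0$; (2) $\mu_0=0$, at least one of $\mu_1,\dots,\mu_{\rho-1}$ is nonzero, and $\mu_k<0$, where $k=\max\{j : 1\leqslant j\leqslant \rho-1,\ \mu_j\neq 0\}$; (3) $\mu_0=0$, $\mu_j=0$ for all $1\leqslant j\leqslant \rho-1$, and $r<0$.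
   Context: A sequence $\{a_n\}_{n\geqslant 1}$ is P-recursive (of order $d$) if there are polynomials $p_0(n),\dots,p_d(n)$ in $n$, not all zero, such that $p_0(n)a_n+p_1(n)a_{n+1}+\cdots+p_d(n)a_{n+d}=0$ for all $n\geqslant 1$. For a non-negative sequence $\{a_n\}_{n\geqslant 1}$, the root sequence $\{\sqrt[n]{a_n}\}_{n\geqslant 1}$ is called asymptotically log-concave if \[ \left(\sqrt[n]{a_n}\right)^2\geqslant \sqrt[n-1]{a_{n-1}}\;\sqrt[n+1]{a_{n+1}} \] holds for all sufficiently large $n$. *)

theory Defs
  imports "HOL-Library.Landau_Symbols" "HOL-Computational_Algebra.Polynomial"
begin

text \<open>
  Sequences \<open>a\<^sub>1, a\<^sub>2, \<dots>\<close> are functions on \<^typ>\<open>nat\<close> whose value at \<open>0\<close> is irrelevant: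
  no definition below depends on \<open>a 0\<close>.
\<close>

definition P_recursive_of_order :: "nat \<Rightarrow> (nat \<Rightarrow> real) \<Rightarrow> bool" where
  "P_recursive_of_order d a \<longleftrightarrow>
     (\<exists>p :: nat \<Rightarrow> real poly.
        (\<exists>i\<le>d. p i \<noteq> 0) \<and>
        (\<forall>n\<ge>1. (\<Sum>i\<le>d. poly (p i) (real n) * a (n + i)) = 0))"

definition P_recursive :: "(nat \<Rightarrow> real) \<Rightarrow> bool" where
  "P_recursive a \<longleftrightarrow> (\<exists>d. P_recursive_of_order d a)"

definition root_seq :: "(nat \<Rightarrow> real) \<Rightarrow> nat \<Rightarrow> real" where
  "root_seq a n = root n (a n)"

definition asymptotically_log_concave :: "(nat \<Rightarrow> real) \<Rightarrow> bool" where
  "asymptotically_log_concave u \<longleftrightarrow>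
     (\<forall>\<^sub>F n in sequentially. (u n)\<^sup>2 \<ge> u (n - 1) * u (n + 1))"

definition Q :: "(nat \<Rightarrow> real) \<Rightarrow> nat \<Rightarrow> nat \<Rightarrow> real" where
  "Q \<mu> \<rho> n = \<mu> 0 * real n * ln (real n) + (\<Sum>j=1..\<rho>. \<mu> j * real n powr (real j / real \<rho>))"

definition has_asymptotic_expansion ::
  "(nat \<Rightarrow> real) \<Rightarrow> nat \<Rightarrow> nat \<Rightarrow> (nat \<Rightarrow> real) \<Rightarrow> real \<Rightarrow> (nat \<Rightarrow> real) \<Rightarrow> bool" where
  "has_asymptotic_expansion a \<rho> M \<mu> r b \<longleftrightarrow>
     (\<exists>e \<in> o(\<lambda>n. real n powr (- (real M / real \<rho>))).
        \<forall>\<^sub>F n in sequentially.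
          a n = exp (Q \<mu> \<rho> n) * real n powr r *
                ((\<Sum>s=0..M. b s * real n powr (- (real s / real \<rho>))) + e n))"

end

theory Submission
  imports Defs "HOL-Analysis.Analysis" "HOL-Real_Asymp.Real_Asymp"
begin

text \<open>
  Taking logarithms, the claim says that \<open>L n = ln (a n) / n\<close> has a nonpositive second difference
  for all large \<open>n\<close>. The expansion splits \<open>L n = F n + \<delta> n\<close>, where
  \<open>F x = \<mu>\<^sub>0 ln x + (\<Sum>j. \<mu>\<^sub>j x\<^bsup>j/\<rho>-1\<^esup>) + r ln x / x + ln (S x) / x\<close> with
  \<open>S x = (\<Sum>s. b\<^sub>s x\<^bsup>-s/\<rho>\<^esup>)\<close> is a smooth function of a real variable and
  \<open>\<delta> n = (ln (S n + e n) - ln (S n)) / n\<close> absorbs the unknown error \<open>e\<close>. Because \<open>M/\<rho> > 2\<close>,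
  this \<open>\<delta>\<close> is \<open>o(n\<^sup>-\<^sup>3)\<close>, and hence so is its second difference.

  The scale \<open>n\<^sup>-\<^sup>3\<close> is the borderline: \<open>x\<^sup>3\<close> times the second derivative of \<open>ln (S x) / x\<close> tends to
  \<open>2 ln b\<^sub>0\<close> and so is bounded, whereas
  \<open>x\<^sup>3 F'' x = - \<mu>\<^sub>0 x + (\<Sum>j. \<mu>\<^sub>j (j/\<rho>-1) (j/\<rho>-2) x\<^bsup>j/\<rho>\<^esup>) + r (2 ln x - 3) + O(1)\<close>.
  The term with \<open>j = \<rho>\<close> vanishes, and \<open>(j/\<rho>-1) (j/\<rho>-2) > 0\<close> for \<open>j < \<rho>\<close>. Under each of the three
  conditions the dominant term, of order \<open>x\<close>, \<open>x\<^bsup>k/\<rho>\<^esup>\<close> and \<open>ln x\<close> respectively, has a negative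
  coefficient, so \<open>x\<^sup>3 F'' x\<close> tends to minus infinity (\<open>dominant_term_at_bot\<close>). The second difference
  of \<open>F\<close> is therefore eventually below \<open>-(n+1)\<^sup>-\<^sup>3\<close>, which outweighs that of \<open>\<delta>\<close>
  (\<open>perturbed_second_difference_nonpos\<close>).
\<close>

section \<open>Second differences\<close>

text \<open>
  Adding \<open>K x\<^sup>2 / 2\<close> to \<open>f\<close> makes it concave, and that quadratic has second difference \<open>K\<close>.
\<close>

lemma second_difference_le:
  fixes f f1 f2 :: "real \<Rightarrow> real"
  assumes "\<And>x. x \<in> {c-1..c+1} \<Longrightarrow> (f has_real_derivative f1 x) (at x)"
    and "\<And>x. x \<in> {c-1..c+1} \<Longrightarrow> (f1 has_real_derivative f2 x) (at x)"
    and "\<And>x. x \<in> {c-1..c+1} \<Longrightarrow> f2 x \<le> - K"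
  shows "f (c - 1) + f (c + 1) - 2 * f c \<le> - K"
proof -
  define g where "g = (\<lambda>x. f x + K * x\<^sup>2 / 2)"
  have "concave_on {c-1..c+1} g"
  proof (rule f''_le0_imp_concave)
    show "(g has_real_derivative f1 x + K * x) (at x)" if "x \<in> {c-1..c+1}" for x
      unfolding g_def by (rule derivative_eq_intros assms(1) that refl | simp)+
    show "((\<lambda>x. f1 x + K * x) has_real_derivative f2 x + K) (at x)" if "x \<in> {c-1..c+1}" for x
      by (rule derivative_eq_intros assms(2) that refl | simp)+
    show "f2 x + K \<le> 0" if "x \<in> {c-1..c+1}" for x
      using assms(3)[OF that] by simp
  qed simp
  then have "g ((1 - 1/2) *\<^sub>R (c - 1) + (1/2) *\<^sub>R (c + 1)) \<ge> (1 - 1/2) * g (c - 1) + (1/2) * g (c + 1)"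
    by (rule concave_onD) auto
  then have "g c \<ge> (g (c - 1) + g (c + 1)) / 2"
    by (simp add: field_simps)
  then show ?thesis
    by (simp add: g_def power2_eq_square field_simps)
qed

text \<open>
  A smooth function whose second derivative is below every negative multiple of \<open>x\<^sup>-\<^sup>3\<close> stays
  discretely concave after a perturbation of size \<open>o(n\<^sup>-\<^sup>3)\<close>: consecutive values of the perturbation
  need not be related, but its second difference is at most four times its largest value, which is
  small compared with the curvature.
\<close>

lemma perturbed_second_difference_nonpos:
  fixes F F1 F2 :: "real \<Rightarrow> real" and \<delta> :: "nat \<Rightarrow> real"
  assumes "\<forall>\<^sub>F x in at_top. (F has_real_derivative F1 x) (at x)"
    and "\<forall>\<^sub>F x in at_top. (F1 has_real_derivative F2 x) (at x)"
    and "filterlim (\<lambda>x. x ^ 3 * F2 x) at_bot at_top"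
    and "(\<lambda>n. real n ^ 3 * \<delta> n) \<longlonglongrightarrow> 0"
  shows "\<forall>\<^sub>F n in sequentially.
           (F (real (n-1)) + \<delta> (n-1)) + (F (real (n+1)) + \<delta> (n+1)) - 2 * (F (real n) + \<delta> n) \<le> 0"
proof -
  have "\<forall>\<^sub>F x in at_top. x ^ 3 * F2 x \<le> -1"
    using assms(3) by (simp add: filterlim_at_bot)
  with assms(1,2) have "\<forall>\<^sub>F x in at_top. (F has_real_derivative F1 x) (at x) \<and>
      (F1 has_real_derivative F2 x) (at x) \<and> x ^ 3 * F2 x \<le> -1"
    by eventually_elim auto
  then obtain X where X: "\<And>x. x \<ge> X \<Longrightarrow> (F has_real_derivative F1 x) (at x)"
      "\<And>x. x \<ge> X \<Longrightarrow> (F1 has_real_derivative F2 x) (at x)" "\<And>x. x \<ge> X \<Longrightarrow> x ^ 3 * F2 x \<le> -1"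
    unfolding eventually_at_top_linorder by blast
  \<comment> \<open>\<open>\<delta>\<close> enters at three points with total weight four, and \<open>m\<^sup>3\<close> is at least \<open>(n+1)\<^sup>3 / 8\<close> at each of
      them, so the bound \<open>1/32\<close> adds up to exactly the available \<open>(n+1)\<^sup>-\<^sup>3\<close>.\<close>
  have "\<forall>\<^sub>F n in sequentially. \<bar>real n ^ 3 * \<delta> n\<bar> < 1/32"
    using tendstoD[OF assms(4), of "1/32"] by simp
  then obtain N where N: "\<And>n. n \<ge> N \<Longrightarrow> \<bar>real n ^ 3 * \<delta> n\<bar> < 1/32"
    unfolding eventually_sequentially by blast
  have "\<forall>\<^sub>F n in sequentially. n \<ge> 3 \<and> n \<ge> N + 1 \<and> real n \<ge> X + 1"
    by (intro eventually_conj eventually_ge_at_top)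
       (use filterlim_real_sequentially in \<open>auto simp: filterlim_at_top\<close>)
  then show ?thesis
  proof eventually_elim
    case (elim n)
    define c where "c = real n"
    have c: "c \<ge> 3" "c \<ge> X + 1" using elim by (auto simp: c_def)
    define K where "K = 1 / (c + 1) ^ 3"
    have smooth: "F (c - 1) + F (c + 1) - 2 * F c \<le> - K"
    proof (rule second_difference_le)
      fix x assume x: "x \<in> {c-1..c+1}"
      show "(F has_real_derivative F1 x) (at x)" "(F1 has_real_derivative F2 x) (at x)"
        using X(1,2)[of x] x c by auto
      have "x > 0" and "x ^ 3 \<le> (c + 1) ^ 3"
        using x c by (auto intro!: power_mono)
      then have "K \<le> 1 / x ^ 3"
        unfolding K_def by (intro divide_left_mono) (use c in auto)
      moreover have "F2 x \<le> - (1 / x ^ 3)"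
        using X(3)[of x] x c \<open>x > 0\<close> by (simp add: field_simps)
      ultimately show "F2 x \<le> - K" by linarith
    qed
    have small: "\<bar>\<delta> m\<bar> \<le> K / 4" if "m \<ge> N" "real m \<ge> c - 1" for m
    proof -
      have "(c + 1) / 2 \<le> real m" using that c by simp
      then have "((c + 1) / 2) ^ 3 \<le> real m ^ 3" using c by (intro power_mono) auto
      then have m3: "(c + 1) ^ 3 / 8 \<le> real m ^ 3" by (simp add: power_divide)
      have "(c + 1) ^ 3 / 8 * \<bar>\<delta> m\<bar> \<le> real m ^ 3 * \<bar>\<delta> m\<bar>"
        by (rule mult_right_mono[OF m3]) simp
      also have "\<dots> \<le> 1/32" using N[OF that(1)] by (simp add: abs_mult)
      finally show ?thesis using c by (simp add: K_def field_simps)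
    qed
    have n1: "real (n - 1) = c - 1" "real (n + 1) = c + 1"
      using elim by (auto simp: c_def of_nat_diff)
    have "\<bar>\<delta> (n-1)\<bar> \<le> K / 4" "\<bar>\<delta> (n+1)\<bar> \<le> K / 4" "\<bar>\<delta> n\<bar> \<le> K / 4"
      using elim n1 c_def by (intro small; linarith)+
    then have "\<delta> (n-1) + \<delta> (n+1) - 2 * \<delta> n \<le> K"
      unfolding abs_le_iff by linarith
    with smooth show ?case
      unfolding n1 c_def[symmetric] by (simp add: algebra_simps)
  qed
qed

text \<open>
  The link with the root sequence: \<open>root n (a n) = exp (ln (a n) / n)\<close> as soon as \<open>a n > 0\<close>.
\<close>

lemma root_seq_asymptotically_log_concaveI:
  fixes a L :: "nat \<Rightarrow> real"
  assumes "\<forall>\<^sub>F n in sequentially. a n > 0 \<and> ln (a n) / real n = L n"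
    and "\<forall>\<^sub>F n in sequentially. L (n-1) + L (n+1) - 2 * L n \<le> 0"
  shows "asymptotically_log_concave (root_seq a)"
proof -
  obtain N where N: "\<And>n. n \<ge> N \<Longrightarrow> a n > 0 \<and> ln (a n) / real n = L n"
    using assms(1) unfolding eventually_sequentially by blast
  have root: "root_seq a n = exp (L n)" if "n \<ge> N" "n > 0" for n
  proof -
    have "root n (a n) = exp (ln (a n) / real n)"
      using N[OF that(1)] that(2) by (simp add: root_powr_inverse powr_def)
    then show ?thesis using N[OF that(1)] by (simp add: root_seq_def)
  qed
  show ?thesis
    unfolding asymptotically_log_concave_def
    using assms(2) eventually_ge_at_top[of "N + 2"]
  proof eventually_elim
    case (elim n)
    have "root_seq a (n-1) * root_seq a (n+1) = exp (L (n-1) + L (n+1))"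
      using elim by (subst (1 2) root) (auto simp: exp_add)
    also have "\<dots> \<le> exp (2 * L n)" using elim by simp
    also have "\<dots> = (root_seq a n)\<^sup>2"
      using elim by (subst root) (auto simp: exp_double)
    finally show ?case .
  qed
qed

section \<open>The smooth part\<close>

lemma power_sum_div_powr_tendsto_0:
  fixes c \<beta> :: "'i \<Rightarrow> real"
  assumes "\<And>j. j \<in> J \<Longrightarrow> c j \<noteq> 0 \<Longrightarrow> \<beta> j < \<kappa>"
  shows "((\<lambda>x. (\<Sum>j\<in>J. c j * x powr \<beta> j) / x powr \<kappa>) \<longlongrightarrow> 0) at_top"
proof -
  have "((\<lambda>x. c j * x powr \<beta> j / x powr \<kappa>) \<longlongrightarrow> 0) at_top" if "j \<in> J" for j
  proof (cases "c j = 0")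
    case False
    then have "\<beta> j < \<kappa>" using assms that by blast
    then have "((\<lambda>x::real. x powr (\<beta> j - \<kappa>)) \<longlongrightarrow> 0) at_top"
      by (intro tendsto_neg_powr filterlim_ident) simp
    then have "((\<lambda>x::real. c j * x powr (\<beta> j - \<kappa>)) \<longlongrightarrow> 0) at_top"
      by (rule tendsto_mult_right_zero)
    then show ?thesis by (simp add: powr_diff)
  qed simp
  then show ?thesis
    unfolding sum_divide_distrib by (rule tendsto_null_sum)
qed

text \<open>
  This is \<open>x\<^sup>3 F'' x\<close>, with \<open>h\<close> for the contribution of \<open>ln (S x) / x\<close>. Under the three conditions,
  dividing by \<open>x\<close>, \<open>x\<^bsup>k/\<rho>\<^esup>\<close> and \<open>ln x\<close> leaves the limits \<open>-\<mu>\<^sub>0\<close>, \<open>\<mu>\<^sub>k (k/\<rho>-1) (k/\<rho>-2)\<close> and \<open>2 r\<close>,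
  which are all negative; the terms other than the dominant one vanish in the limit.
\<close>

lemma dominant_term_at_bot:
  fixes \<mu> :: "nat \<Rightarrow> real" and r l :: real and h :: "real \<Rightarrow> real" and \<rho> :: nat
  assumes "\<rho> > 0" and h: "(h \<longlongrightarrow> l) at_top"
    and cases: "\<mu> 0 > 0
       \<or> (\<mu> 0 = 0 \<and> (\<exists>j\<in>{1..\<rho>-1}. \<mu> j \<noteq> 0) \<and> \<mu> (Max {j. 1 \<le> j \<and> j \<le> \<rho> - 1 \<and> \<mu> j \<noteq> 0}) < 0)
       \<or> (\<mu> 0 = 0 \<and> (\<forall>j\<in>{1..\<rho>-1}. \<mu> j = 0) \<and> r < 0)"
  shows "filterlim (\<lambda>x. - \<mu> 0 * x
            + (\<Sum>j=1..\<rho>. \<mu> j * (real j / real \<rho> - 1) * (real j / real \<rho> - 2) * x powr (real j / real \<rho>))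
            + r * (2 * ln x - 3) + h x) at_bot at_top"
proof -
  define q where "q = (\<lambda>j. real j / real \<rho>)"
  define w where "w = (\<lambda>j. \<mu> j * (q j - 1) * (q j - 2))"
  define W where "W = (\<lambda>x. \<Sum>j=1..\<rho>. w j * x powr q j)"
  define G where "G = (\<lambda>x. - \<mu> 0 * x + W x + r * (2 * ln x - 3) + h x)"
  have w_top: "w \<rho> = 0" using \<open>\<rho> > 0\<close> by (simp add: w_def q_def)
  have q_less: "q i < q j \<longleftrightarrow> i < j" for i j
    using \<open>\<rho> > 0\<close> by (simp add: q_def divide_less_cancel)
  have q1: "q \<rho> = 1" using \<open>\<rho> > 0\<close> by (simp add: q_def)
  have at_botI: "filterlim G at_bot at_top"
    if "((\<lambda>x. G x / g x) \<longlongrightarrow> c) at_top" "c < 0" "filterlim g at_top at_top" for g c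
  proof -
    have "filterlim (\<lambda>x. G x / g x * g x) at_bot at_top"
      by (rule filterlim_tendsto_neg_mult_at_bot[OF that])
    moreover have "\<forall>\<^sub>F x in at_top. g x > 0"
      using that(3) by (simp add: filterlim_at_top_dense)
    then have "\<forall>\<^sub>F x in at_top. G x / g x * g x = G x"
      by eventually_elim simp
    ultimately show ?thesis by (rule filterlim_mono_eventually[OF _ order.refl order.refl])
  qed
  from cases consider "\<mu> 0 > 0"
    | "\<mu> 0 = 0" "\<exists>j\<in>{1..\<rho>-1}. \<mu> j \<noteq> 0" "\<mu> (Max {j. 1 \<le> j \<and> j \<le> \<rho> - 1 \<and> \<mu> j \<noteq> 0}) < 0"
    | "\<mu> 0 = 0" "\<forall>j\<in>{1..\<rho>-1}. \<mu> j = 0" "r < 0" by blast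
  then have "filterlim G at_bot at_top"
  proof cases
    case 1
    have "((\<lambda>x. W x / x powr 1) \<longlongrightarrow> 0) at_top"
      unfolding W_def
    proof (rule power_sum_div_powr_tendsto_0)
      fix j assume "j \<in> {1..\<rho>}" "w j \<noteq> 0"
      with w_top have "j < \<rho>" by (cases "j = \<rho>") auto
      then show "q j < 1" using q_less[of j \<rho>] q1 by simp
    qed
    moreover have "((\<lambda>x. r * ((2 * ln x - 3) / x powr 1)) \<longlongrightarrow> r * 0) at_top"
      by (intro tendsto_intros) real_asymp
    moreover have "((\<lambda>x. h x * (1 / x powr 1)) \<longlongrightarrow> l * 0) at_top"
      by (intro tendsto_mult h) real_asymp
    moreover have "((\<lambda>x. - \<mu> 0 * (x / x powr 1)) \<longlongrightarrow> - \<mu> 0 * 1) at_top"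
      by (intro tendsto_mult tendsto_const) real_asymp
    ultimately have "((\<lambda>x. - \<mu> 0 * (x / x powr 1) + W x / x powr 1
        + r * ((2 * ln x - 3) / x powr 1) + h x * (1 / x powr 1))
        \<longlongrightarrow> - \<mu> 0 * 1 + 0 + r * 0 + l * 0) at_top"
      by (intro tendsto_add)
    then have "((\<lambda>x. G x / x powr 1) \<longlongrightarrow> - \<mu> 0) at_top"
      unfolding G_def by (simp add: add_divide_distrib diff_divide_distrib right_diff_distrib)
    then show ?thesis
      by (rule at_botI) (use 1 in simp, real_asymp)
  next
    case 2
    define A where "A = {j. 1 \<le> j \<and> j \<le> \<rho> - 1 \<and> \<mu> j \<noteq> 0}"
    define k where "k = Max A"
    have fin: "finite A" by (rule finite_subset[of _ "{..\<rho>}"]) (auto simp: A_def)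
    moreover have "A \<noteq> {}" using 2(2) by (auto simp: A_def)
    ultimately have "k \<in> A" unfolding k_def by (rule Max_in)
    then have k: "1 \<le> k" "k < \<rho>" using \<open>\<rho> > 0\<close> by (auto simp: A_def)
    have "\<mu> k < 0" using 2(3) by (simp add: k_def A_def)
    have qk: "0 < q k" "q k < 1" using k q_less[of k \<rho>] q1 by (auto simp: q_def)
    have "(q k - 1) * (q k - 2) > 0" using qk by (intro mult_neg_neg) auto
    then have "w k < 0" using \<open>\<mu> k < 0\<close> by (simp add: w_def mult.assoc mult_neg_pos)
    have W_split: "W x = w k * x powr q k + (\<Sum>j\<in>{1..\<rho>} - {k}. w j * x powr q j)" for x
      unfolding W_def using k by (intro sum.remove) auto
    have "((\<lambda>x. (\<Sum>j\<in>{1..\<rho>} - {k}. w j * x powr q j) / x powr q k) \<longlongrightarrow> 0) at_top"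
    proof (rule power_sum_div_powr_tendsto_0)
      fix j assume j: "j \<in> {1..\<rho>} - {k}" "w j \<noteq> 0"
      then have "j \<noteq> \<rho>" "\<mu> j \<noteq> 0" using w_top by (auto simp: w_def)
      then have "j \<in> A" using j by (auto simp: A_def)
      then have "j \<le> k" using fin by (simp add: k_def)
      then show "q j < q k" using j q_less by auto
    qed
    moreover have "((\<lambda>x. r * ((2 * ln x - 3) / x powr q k)) \<longlongrightarrow> r * 0) at_top"
      by (intro tendsto_mult tendsto_const) (use qk in real_asymp)
    moreover have "((\<lambda>x. h x * (1 / x powr q k)) \<longlongrightarrow> l * 0) at_top"
      by (intro tendsto_mult h) (use qk in real_asymp)
    moreover have "((\<lambda>x. w k * (x powr q k / x powr q k)) \<longlongrightarrow> w k * 1) at_top"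
      by (intro tendsto_mult tendsto_const) (use qk in real_asymp)
    ultimately have "((\<lambda>x. w k * (x powr q k / x powr q k)
        + (\<Sum>j\<in>{1..\<rho>} - {k}. w j * x powr q j) / x powr q k
        + r * ((2 * ln x - 3) / x powr q k) + h x * (1 / x powr q k))
        \<longlongrightarrow> w k * 1 + 0 + r * 0 + l * 0) at_top"
      by (intro tendsto_add)
    then have "((\<lambda>x. G x / x powr q k) \<longlongrightarrow> w k) at_top"
      unfolding G_def W_split using 2(1) by (simp add: add_divide_distrib if_distrib cong: if_cong)
    then show ?thesis
      by (rule at_botI) (use \<open>w k < 0\<close> in simp, use qk in real_asymp)
  next
    case 3
    have "w j = 0" if "j \<in> {1..\<rho>}" for j
      using 3(2) w_top that by (cases "j = \<rho>") (auto simp: w_def)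
    then have W0: "W x = 0" for x by (simp add: W_def)
    have "((\<lambda>x. r * ((2 * ln x - 3) / ln x)) \<longlongrightarrow> r * 2) at_top"
      by (intro tendsto_mult tendsto_const) real_asymp
    moreover have "((\<lambda>x. h x * (1 / ln x)) \<longlongrightarrow> l * 0) at_top"
      by (intro tendsto_mult h) real_asymp
    ultimately have "((\<lambda>x. r * ((2 * ln x - 3) / ln x) + h x * (1 / ln x))
        \<longlongrightarrow> r * 2 + l * 0) at_top"
      by (intro tendsto_add)
    then have "((\<lambda>x. G x / ln x) \<longlongrightarrow> r * 2) at_top"
      unfolding G_def W0 using 3(1) by (simp add: add_divide_distrib)
    then show ?thesis
      by (rule at_botI) (use 3 in simp, real_asymp)
  qed
  then show ?thesis by (simp add: G_def W_def w_def q_def)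
qed

text \<open>
  The amplitude contributes at the borderline scale only: differentiating a sum of powers costs a
  factor \<open>1/x\<close> each time and kills the constant term, so \<open>x S' x\<close> and \<open>x\<^sup>2 S'' x\<close> vanish in the
  limit, and what survives of \<open>x\<^sup>3 (ln (S x) / x)''\<close> is \<open>2 ln (S x)\<close>.
\<close>

lemma ln_amplitude_second_derivative:
  fixes S S1 S2 :: "real \<Rightarrow> real"
  assumes S1: "\<And>x. x > 0 \<Longrightarrow> (S has_real_derivative S1 x) (at x)"
    and S2: "\<And>x. x > 0 \<Longrightarrow> (S1 has_real_derivative S2 x) (at x)"
    and lim: "(S \<longlongrightarrow> B) at_top" "((\<lambda>x. x * S1 x) \<longlongrightarrow> 0) at_top" "((\<lambda>x. x\<^sup>2 * S2 x) \<longlongrightarrow> 0) at_top"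
    and "B > 0"
  obtains H1 H2 where
    "\<forall>\<^sub>F x in at_top. ((\<lambda>x. ln (S x) / x) has_real_derivative H1 x) (at x)"
    "\<forall>\<^sub>F x in at_top. (H1 has_real_derivative H2 x) (at x)"
    "((\<lambda>x. x ^ 3 * H2 x) \<longlongrightarrow> 2 * ln B) at_top"
proof
  define H1 where "H1 = (\<lambda>x. S1 x / S x / x - ln (S x) / x\<^sup>2)"
  define H2 where "H2 = (\<lambda>x. (S2 x / S x - (S1 x / S x)\<^sup>2) / x - 2 * (S1 x / S x) / x\<^sup>2
                              + 2 * ln (S x) / x ^ 3)"
  have pos: "\<forall>\<^sub>F x in at_top. S x > 0 \<and> x > 0"
    using order_tendstoD(1)[OF lim(1) \<open>B > 0\<close>] eventually_gt_at_top[of 0] by eventually_elim simp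
  then show "\<forall>\<^sub>F x in at_top. ((\<lambda>x. ln (S x) / x) has_real_derivative H1 x) (at x)"
  proof eventually_elim
    case (elim x)
    show ?case unfolding H1_def
      by (rule derivative_eq_intros S1 refl | use elim in \<open>force simp: field_simps power2_eq_square\<close>)+
  qed
  from pos show "\<forall>\<^sub>F x in at_top. (H1 has_real_derivative H2 x) (at x)"
  proof eventually_elim
    case (elim x)
    show ?case unfolding H1_def H2_def
      by (rule derivative_eq_intros S1 S2 refl
          | use elim in \<open>force simp: field_simps power2_eq_square power3_eq_cube\<close>)+
  qed
  have "((\<lambda>x. x\<^sup>2 * S2 x / S x - (x * S1 x / S x)\<^sup>2 - 2 * (x * S1 x / S x) + 2 * ln (S x))
      \<longlongrightarrow> 0 / B - (0 / B)\<^sup>2 - 2 * (0 / B) + 2 * ln B) at_top"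
    using \<open>B > 0\<close> by (intro tendsto_intros lim) auto
  moreover have "\<forall>\<^sub>F x in at_top. x\<^sup>2 * S2 x / S x - (x * S1 x / S x)\<^sup>2 - 2 * (x * S1 x / S x)
      + 2 * ln (S x) = x ^ 3 * H2 x"
    using pos
  proof eventually_elim
    case (elim x)
    then have "S x \<noteq> 0" "x \<noteq> 0" by auto
    then show ?case by (simp add: H2_def field_simps power2_eq_square power3_eq_cube)
  qed
  ultimately show "((\<lambda>x. x ^ 3 * H2 x) \<longlongrightarrow> 2 * ln B) at_top"
    by (simp add: tendsto_cong)
qed

lemma power_sum_has_derivative:
  fixes c \<beta> :: "'i \<Rightarrow> real"
  assumes "x > 0"
  shows "((\<lambda>x. \<Sum>j\<in>J. c j * x powr \<beta> j) has_real_derivative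
            (\<Sum>j\<in>J. c j * \<beta> j * x powr (\<beta> j - 1))) (at x)"
  using assms by (intro DERIV_sum) (auto intro!: derivative_eq_intros simp: mult.assoc)

text \<open>
  An additive error \<open>e n\<close> in the amplitude changes \<open>ln (S n) / n\<close> by about \<open>e n / (B n)\<close>, one order
  less than \<open>e\<close> itself: reading \<open>ln y - ln z \<le> (y - z) / z\<close> in both directions puts
  \<open>ln (S n + e n) - ln (S n)\<close> between \<open>e n / (S n + e n)\<close> and \<open>e n / S n\<close>.
\<close>

lemma ln_amplitude_error:
  fixes S e :: "nat \<Rightarrow> real"
  assumes S: "S \<longlonglongrightarrow> B" and "B > 0" and e: "(\<lambda>n. real n ^ 2 * e n) \<longlonglongrightarrow> 0"
  shows "\<forall>\<^sub>F n in sequentially. S n > 0 \<and> S n + e n > 0"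
    and "(\<lambda>n. real n ^ 3 * ((ln (S n + e n) - ln (S n)) / real n)) \<longlonglongrightarrow> 0"
proof -
  have "(\<lambda>n. 1 / real n ^ 2) \<longlonglongrightarrow> 0" by real_asymp
  from tendsto_mult[OF e this] have "(\<lambda>n. real n ^ 2 * e n * (1 / real n ^ 2)) \<longlonglongrightarrow> 0" by simp
  moreover have "\<forall>\<^sub>F n in sequentially. real n ^ 2 * e n * (1 / real n ^ 2) = e n"
    using eventually_gt_at_top[of 0] by eventually_elim simp
  ultimately have "e \<longlonglongrightarrow> 0" by (simp add: tendsto_cong)
  then have Se: "(\<lambda>n. S n + e n) \<longlonglongrightarrow> B" using tendsto_add[OF S] by force
  show pos: "\<forall>\<^sub>F n in sequentially. S n > 0 \<and> S n + e n > 0"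
    using order_tendstoD(1)[OF S \<open>B > 0\<close>] order_tendstoD(1)[OF Se \<open>B > 0\<close>]
    by eventually_elim simp
  show "(\<lambda>n. real n ^ 3 * ((ln (S n + e n) - ln (S n)) / real n)) \<longlonglongrightarrow> 0"
  proof (rule tendsto_sandwich)
    show "(\<lambda>n. real n ^ 2 * e n / (S n + e n)) \<longlonglongrightarrow> 0" "(\<lambda>n. real n ^ 2 * e n / S n) \<longlonglongrightarrow> 0"
      using tendsto_divide[OF e Se] tendsto_divide[OF e S] \<open>B > 0\<close> by auto
    have cube: "real n ^ 3 * (t / real n) = real n ^ 2 * t" for n t
      by (cases "n = 0") (auto simp: power2_eq_square power3_eq_cube)
    show "\<forall>\<^sub>F n in sequentially. real n ^ 3 * ((ln (S n + e n) - ln (S n)) / real n)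
        \<le> real n ^ 2 * e n / S n"
      using pos
    proof eventually_elim
      case (elim n)
      then have "ln (S n + e n) - ln (S n) \<le> e n / S n"
        using ln_diff_le[of "S n + e n" "S n"] by simp
      then show ?case
        unfolding cube times_divide_eq_right[symmetric] by (intro mult_left_mono) auto
    qed
    show "\<forall>\<^sub>F n in sequentially. real n ^ 2 * e n / (S n + e n)
        \<le> real n ^ 3 * ((ln (S n + e n) - ln (S n)) / real n)"
      using pos
    proof eventually_elim
      case (elim n)
      then have "ln (S n) - ln (S n + e n) \<le> - e n / (S n + e n)"
        using ln_diff_le[of "S n" "S n + e n"] by simp
      then have "e n / (S n + e n) \<le> ln (S n + e n) - ln (S n)" by simp
      then show ?case
        unfolding cube times_divide_eq_right[symmetric] by (intro mult_left_mono) auto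
    qed
  qed
qed

section \<open>Log-concavity of the root sequence\<close>

theorem theorem2p1:
  fixes a :: "nat \<Rightarrow> real" and \<rho> M :: nat
    and \<mu> b :: "nat \<Rightarrow> real" and r :: real
  assumes "P_recursive a"
    and "\<forall>n\<ge>1. a n \<ge> 0"
    and "\<rho> > 0" and "M > 0"
    and "b 0 > 0" and "real M / real \<rho> > 2"
    and "has_asymptotic_expansion a \<rho> M \<mu> r b"
    and "\<mu> 0 > 0
       \<or> (\<mu> 0 = 0 \<and> (\<exists>j\<in>{1..\<rho>-1}. \<mu> j \<noteq> 0) \<and> \<mu> (Max {j. 1 \<le> j \<and> j \<le> \<rho> - 1 \<and> \<mu> j \<noteq> 0}) < 0)
       \<or> (\<mu> 0 = 0 \<and> (\<forall>j\<in>{1..\<rho>-1}. \<mu> j = 0) \<and> r < 0)"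
  shows "asymptotically_log_concave (root_seq a)"
proof -
  from assms(7) obtain e where e: "e \<in> o(\<lambda>n. real n powr (- (real M / real \<rho>)))"
    and a: "\<forall>\<^sub>F n in sequentially. a n = exp (Q \<mu> \<rho> n) * real n powr r *
                ((\<Sum>s=0..M. b s * real n powr (- (real s / real \<rho>))) + e n)"
    unfolding has_asymptotic_expansion_def by blast
  define q where "q = (\<lambda>j. real j / real \<rho>)"
  define S where "S = (\<lambda>x. \<Sum>s=0..M. b s * x powr (- q s))"
  define S1 where "S1 = (\<lambda>x. \<Sum>s=0..M. b s * (- q s) * x powr (- q s - 1))"
  define S2 where "S2 = (\<lambda>x. \<Sum>s=0..M. b s * (- q s) * (- q s - 1) * x powr (- q s - 1 - 1))"

  have q_pos: "q s > 0" if "s > 0" for s using that \<open>\<rho> > 0\<close> by (simp add: q_def)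
  have q0: "q 0 = 0" by (simp add: q_def)
  have q_pos': "q s > 0" if "q s \<noteq> 0" for s using that q0 q_pos[of s] by (cases "s = 0") auto

  have "((\<lambda>x. b 0 + (\<Sum>s=1..M. b s * x powr (- q s)) / x powr 0) \<longlongrightarrow> b 0 + 0) at_top"
    by (intro tendsto_add tendsto_const power_sum_div_powr_tendsto_0) (auto intro: q_pos)
  moreover have "\<forall>\<^sub>F x in at_top. b 0 + (\<Sum>s=1..M. b s * x powr (- q s)) / x powr 0 = S x"
    using eventually_gt_at_top[of "0::real"]
    by eventually_elim (simp add: S_def q0 sum.atLeast_Suc_atMost)
  ultimately have S_lim: "(S \<longlongrightarrow> b 0) at_top" by (simp add: tendsto_cong)

  have "((\<lambda>x. (\<Sum>s=0..M. b s * (- q s) * x powr (- q s)) / x powr 0) \<longlongrightarrow> 0) at_top"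
    by (intro power_sum_div_powr_tendsto_0) (use q_pos' in auto)
  moreover have "\<forall>\<^sub>F x in at_top. (\<Sum>s=0..M. b s * (- q s) * x powr (- q s)) / x powr 0 = x * S1 x"
    using eventually_gt_at_top[of "0::real"]
    by eventually_elim (simp add: S1_def sum_distrib_left powr_diff)
  ultimately have S1_lim: "((\<lambda>x. x * S1 x) \<longlongrightarrow> 0) at_top" by (simp add: tendsto_cong)

  have "((\<lambda>x. (\<Sum>s=0..M. b s * (- q s) * (- q s - 1) * x powr (- q s)) / x powr 0) \<longlongrightarrow> 0) at_top"
    by (intro power_sum_div_powr_tendsto_0) (use q_pos' in auto)
  moreover have "\<forall>\<^sub>F x in at_top. (\<Sum>s=0..M. b s * (- q s) * (- q s - 1) * x powr (- q s)) / x powr 0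
      = x\<^sup>2 * S2 x"
    using eventually_gt_at_top[of "0::real"]
  proof eventually_elim
    case (elim x)
    have step: "x powr t = x * x powr (t - 1)" for t
      using elim by (simp add: powr_diff)
    have "x powr (- q s) = x\<^sup>2 * x powr (- q s - 1 - 1)" for s
      using step[of "- q s"] step[of "- q s - 1"] by (simp add: power2_eq_square)
    then show ?case using elim
      by (simp add: S2_def sum_distrib_left mult_ac)
  qed
  ultimately have S2_lim: "((\<lambda>x. x\<^sup>2 * S2 x) \<longlongrightarrow> 0) at_top" by (simp add: tendsto_cong)

  have "(S has_real_derivative S1 x) (at x)" "(S1 has_real_derivative S2 x) (at x)" if "x > 0" for x
    unfolding S_def S1_def S2_def by (rule power_sum_has_derivative[OF that])+
  from ln_amplitude_second_derivative[OF this S_lim S1_lim S2_lim \<open>b 0 > 0\<close>]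
  obtain H1 H2 where
    H1: "\<forall>\<^sub>F x in at_top. ((\<lambda>x. ln (S x) / x) has_real_derivative H1 x) (at x)" and
    H2: "\<forall>\<^sub>F x in at_top. (H1 has_real_derivative H2 x) (at x)" and
    H2_lim: "((\<lambda>x. x ^ 3 * H2 x) \<longlongrightarrow> 2 * ln (b 0)) at_top"
    by blast

  define F where "F = (\<lambda>x. \<mu> 0 * ln x + (\<Sum>j=1..\<rho>. \<mu> j * x powr (q j - 1)) + r * (ln x / x) + ln (S x) / x)"
  define F1 where "F1 = (\<lambda>x. \<mu> 0 / x + (\<Sum>j=1..\<rho>. \<mu> j * (q j - 1) * x powr (q j - 1 - 1))
      + r * ((1 - ln x) / x\<^sup>2) + H1 x)"
  define F2 where "F2 = (\<lambda>x. - \<mu> 0 / x\<^sup>2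
      + (\<Sum>j=1..\<rho>. \<mu> j * (q j - 1) * (q j - 1 - 1) * x powr (q j - 1 - 1 - 1))
      + r * ((2 * ln x - 3) / x ^ 3) + H2 x)"

  have F_deriv: "\<forall>\<^sub>F x in at_top. (F has_real_derivative F1 x) (at x)"
    using H1 eventually_gt_at_top[of 0]
  proof eventually_elim
    case (elim x)
    have "((\<lambda>x. \<mu> 0 * ln x) has_real_derivative \<mu> 0 / x) (at x)"
      using elim by (auto intro!: derivative_eq_intros)
    moreover have "((\<lambda>x. r * (ln x / x)) has_real_derivative r * ((1 - ln x) / x\<^sup>2)) (at x)"
      using elim by (auto intro!: derivative_eq_intros simp: power2_eq_square right_diff_distrib)
    ultimately show ?case unfolding F_def F1_def
      by (intro DERIV_add power_sum_has_derivative elim)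
  qed
  have F1_deriv: "\<forall>\<^sub>F x in at_top. (F1 has_real_derivative F2 x) (at x)"
    using H2 eventually_gt_at_top[of 0]
  proof eventually_elim
    case (elim x)
    have "((\<lambda>x. \<mu> 0 / x) has_real_derivative - \<mu> 0 / x\<^sup>2) (at x)"
      using elim by (auto intro!: derivative_eq_intros simp: power2_eq_square)
    moreover have "((\<lambda>x. r * ((1 - ln x) / x\<^sup>2)) has_real_derivative r * ((2 * ln x - 3) / x ^ 3)) (at x)"
      using elim by (auto intro!: derivative_eq_intros simp: power2_eq_square power3_eq_cube field_simps)
    ultimately show ?case unfolding F1_def F2_def
      by (intro DERIV_add power_sum_has_derivative elim)
  qed

  have F2_lim: "filterlim (\<lambda>x. x ^ 3 * F2 x) at_bot at_top"
  proof (rule filterlim_mono_eventually[OF dominant_term_at_bot[OF \<open>\<rho> > 0\<close> H2_lim assms(8)]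
        order.refl order.refl])
    show "\<forall>\<^sub>F x in at_top. - \<mu> 0 * x
        + (\<Sum>j=1..\<rho>. \<mu> j * (real j / real \<rho> - 1) * (real j / real \<rho> - 2) * x powr (real j / real \<rho>))
        + r * (2 * ln x - 3) + x ^ 3 * H2 x = x ^ 3 * F2 x"
      using eventually_gt_at_top[of 0]
    proof eventually_elim
      case (elim x)
      have "x powr q j = x ^ 3 * x powr (q j - 1 - 1 - 1)" for j
        using elim by (simp add: powr_diff power3_eq_cube)
      then have "(\<Sum>j=1..\<rho>. \<mu> j * (q j - 1) * (q j - 2) * x powr q j)
          = x ^ 3 * (\<Sum>j=1..\<rho>. \<mu> j * (q j - 1) * (q j - 1 - 1) * x powr (q j - 1 - 1 - 1))"
        by (simp add: sum_distrib_left mult_ac)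
      moreover have "x ^ 3 * (- \<mu> 0 / x\<^sup>2) = - \<mu> 0 * x" "x ^ 3 * (r * ((2 * ln x - 3) / x ^ 3)) = r * (2 * ln x - 3)"
        using elim by (auto simp: power2_eq_square power3_eq_cube)
      ultimately show ?case
        unfolding F2_def distrib_left q_def by simp
    qed
  qed

  define \<delta> where "\<delta> = (\<lambda>n. (ln (S (real n) + e n) - ln (S (real n))) / real n)"
  have S_seq: "(\<lambda>n. S (real n)) \<longlonglongrightarrow> b 0"
    by (rule filterlim_compose[OF S_lim filterlim_real_sequentially])
  have "(\<lambda>n. real n powr (- (real M / real \<rho>))) \<in> o(\<lambda>n. real n powr (-2))"
    using assms(6) by real_asymp
  from landau_o.small_trans[OF e this] have "(\<lambda>n. e n / real n powr (-2)) \<longlonglongrightarrow> 0"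
    by (rule smalloD_tendsto)
  moreover have "\<forall>\<^sub>F n in sequentially. e n / real n powr (-2) = real n ^ 2 * e n"
    using eventually_gt_at_top[of 0]
    by eventually_elim (simp add: powr_minus powr_numeral field_simps)
  ultimately have e_lim: "(\<lambda>n. real n ^ 2 * e n) \<longlonglongrightarrow> 0" by (simp add: tendsto_cong)
  note S_pos = ln_amplitude_error(1)[OF S_seq \<open>b 0 > 0\<close> e_lim]
  have \<delta>_lim: "(\<lambda>n. real n ^ 3 * \<delta> n) \<longlonglongrightarrow> 0"
    unfolding \<delta>_def by (rule ln_amplitude_error(2)[OF S_seq \<open>b 0 > 0\<close> e_lim])

  show ?thesis
  proof (rule root_seq_asymptotically_log_concaveI)
    show "\<forall>\<^sub>F n in sequentially. a n > 0 \<and> ln (a n) / real n = F (real n) + \<delta> n"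
      using a S_pos eventually_gt_at_top[of 0]
    proof eventually_elim
      case (elim n)
      have an: "a n = exp (Q \<mu> \<rho> n) * real n powr r * (S (real n) + e n)"
        using elim(1) by (simp add: S_def q_def)
      have "ln (a n) = Q \<mu> \<rho> n + r * ln (real n) + ln (S (real n) + e n)"
        unfolding an using elim by (simp add: ln_mult ln_powr)
      moreover have "Q \<mu> \<rho> n / real n = \<mu> 0 * ln (real n) + (\<Sum>j=1..\<rho>. \<mu> j * real n powr (q j - 1))"
        using elim by (simp add: Q_def q_def add_divide_distrib sum_divide_distrib powr_diff)
      ultimately have "ln (a n) / real n = F (real n) + \<delta> n"
        by (simp add: F_def \<delta>_def add_divide_distrib diff_divide_distrib)
      moreover have "a n > 0" unfolding an using elim by simp
      ultimately show ?case by simp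
    qed
    show "\<forall>\<^sub>F n in sequentially. (F (real (n-1)) + \<delta> (n-1)) + (F (real (n+1)) + \<delta> (n+1))
        - 2 * (F (real n) + \<delta> n) \<le> 0"
      by (rule perturbed_second_difference_nonpos[OF F_deriv F1_deriv F2_lim \<delta>_lim])
  qed
qed

end
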